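(* Let $F\colon U\to\mathbb{H}$ be a function on a region $U\subset\mathbb{H}$. If $F$ is skew regular on $U$, then it is slice regular on $U$, and moreover its skew derivative is equal to its slice derivative.
   Context: $\mathbb{H}$ is the skew field of quaternions with its Euclidean topology, $\mathbb{H}^*=\mathbb{H}\setminus\{0\}$. $\mathbb{H}^*$ acts on $\mathbb{H}$ by ${}^{p}q=pqp^{-1}$; $O(q)$ is the orbit of $q$. A region is a subset of $\mathbb{H}$ that is open and invariant under this action. $T$ denotes the identity function, and a constant function is denoted by its value. Skew product: for $F,G\colon X\to\mathbb{H}$ on an invariant set $X$, $(F\diamond G)(x)=F({}^{G(x)}x)\,G(x)$ if $G(x)\neq0$, and $(F\diamond G)(x)=0$ if $G(x)=0$. A function is skew invertible if it has a two-sided inverse with respect to $\diamond$ (unit: the constant function $1$); the skew inverse of $F$ is written $F^{\langle-1\rangle}$. For $q_0\in\mathbb{H}$, $T-q_0$ is skew invertible on $\mathbb{H}\setminus O(q_0)$. Skew regularity: $F\colon U\to\mathbb{H}$ on a region $U$ is skew differentiable at $q\in U$ if there is a function $\mathcal{D}_q(F)\colon U\to\mathbb{H}$ continuous at all $p\in O(q)$ with $F=F(q)+\mathcal{D}_q(F)\diamond(T-q)$ on $U$ (such a function is unique). $F$ is skew regular on $U$ if it is skew differentiable at all points of $U$. The skew derivative at $q_0$ is $F'(q_0)=\lim_{q\to q_0,\ q\notin O(q_0)}\left((F-F(q_0))\diamond(T-q_0)^{\langle-1\rangle}\right)(q)$ (equivalently $\mathcal{D}_{q_0}(F)(q_0)$).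 Slice regularity: let $\mathbb{S}=\{I\in\mathbb{H}: I^2=-1\}$, and for $I\in\mathbb{S}$, $U_I=U\cap(\mathbb{R}+\mathbb{R}I)$ with coordinates $x+yI$. $F\colon U\to\mathbb{H}$ on an open set $U$ is slice regular if for each $I\in\mathbb{S}$ the restriction $F_I$ of $F$ to $U_I$ has continuous partial derivatives and $\frac12\left(\frac{\partial F_I}{\partial x}+\frac{\partial F_I}{\partial y}I\right)=0$ on $U_I$. Its slice derivative at $q\in U_I$ is $F_s'(q)=\frac12\left(\frac{\partial F_I}{\partial x}-\frac{\partial F_I}{\partial y}I\right)(q)$. *)

theory Defs
  imports "HOL-Analysis.Analysis"
begin

section \<open>The skew field of quaternions with its Euclidean topology\<close>

datatype quat = Quat (qre: real) (qi: real) (qj: real) (qk: real)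

lemma quat_eq_iff: "p = q \<longleftrightarrow> qre p = qre q \<and> qi p = qi q \<and> qj p = qj q \<and> qk p = qk q"
  by (cases p; cases q) simp

instantiation quat :: ring_1
begin

definition zero_quat :: quat where "0 = Quat 0 0 0 0"
definition one_quat :: quat where "1 = Quat 1 0 0 0"
definition plus_quat :: "quat \<Rightarrow> quat \<Rightarrow> quat" where
  "p + q = Quat (qre p + qre q) (qi p + qi q) (qj p + qj q) (qk p + qk q)"
definition minus_quat :: "quat \<Rightarrow> quat \<Rightarrow> quat" where
  "p - q = Quat (qre p - qre q) (qi p - qi q) (qj p - qj q) (qk p - qk q)"
definition uminus_quat :: "quat \<Rightarrow> quat" where
  "- q = Quat (- qre q) (- qi q) (- qj q) (- qk q)"
definition times_quat :: "quat \<Rightarrow> quat \<Rightarrow> quat" where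
  "p * q = Quat (qre p * qre q - qi p * qi q - qj p * qj q - qk p * qk q)
                (qre p * qi q + qi p * qre q + qj p * qk q - qk p * qj q)
                (qre p * qj q - qi p * qk q + qj p * qre q + qk p * qi q)
                (qre p * qk q + qi p * qj q - qj p * qi q + qk p * qre q)"

instance
  by standard
    (auto simp: quat_eq_iff zero_quat_def one_quat_def plus_quat_def minus_quat_def
      uminus_quat_def times_quat_def algebra_simps)

end

instantiation quat :: real_algebra_1
begin

definition scaleR_quat :: "real \<Rightarrow> quat \<Rightarrow> quat" where
  "r *\<^sub>R q = Quat (r * qre q) (r * qi q) (r * qj q) (r * qk q)"

instance
  by standard
    (auto simp: quat_eq_iff scaleR_quat_def plus_quat_def times_quat_def algebra_simps)

end

instantiation quat :: real_inner
begin

definition inner_quat :: "quat \<Rightarrow> quat \<Rightarrow> real" where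
  "inner p q = qre p * qre q + qi p * qi q + qj p * qj q + qk p * qk q"
definition norm_quat :: "quat \<Rightarrow> real" where
  "norm q = sqrt (inner q q)" for q :: quat
definition sgn_quat :: "quat \<Rightarrow> quat" where
  "sgn q = q /\<^sub>R norm q" for q :: quat
definition dist_quat :: "quat \<Rightarrow> quat \<Rightarrow> real" where
  "dist p q = norm (p - q)" for p q :: quat
definition uniformity_quat :: "(quat \<times> quat) filter" where
  "(uniformity :: (quat \<times> quat) filter) = (INF e\<in>{0 <..}. principal {(x, y). dist x y < e})"
definition open_quat :: "quat set \<Rightarrow> bool" where
  "open S \<longleftrightarrow> (\<forall>x\<in>S. eventually (\<lambda>(x', y). x' = x \<longrightarrow> y \<in> S) uniformity)" for S :: "quat set"

instance
proof
  fix p q r :: quat and a :: real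
  show "inner p q = inner q p" "inner (p + q) r = inner p r + inner q r"
    "inner (a *\<^sub>R p) q = a * inner p q" "0 \<le> inner p p"
    by (simp_all add: inner_quat_def scaleR_quat_def plus_quat_def algebra_simps)
  have "x * x + y * y + z * z + w * w = 0 \<longleftrightarrow> x = 0 \<and> y = 0 \<and> z = 0 \<and> w = 0"
    for x y z w :: real
    by (simp only: add_nonneg_eq_0_iff add_nonneg_nonneg zero_le_square mult_eq_0_iff) blast
  then show "inner p p = 0 \<longleftrightarrow> p = 0"
    by (simp add: quat_eq_iff inner_quat_def zero_quat_def)
qed (fact sgn_quat_def dist_quat_def uniformity_quat_def open_quat_def norm_quat_def)+

end

instantiation quat :: inverse
begin

definition inverse_quat :: "quat \<Rightarrow> quat" where
  "inverse q = Quat (qre q) (- qi q) (- qj q) (- qk q) /\<^sub>R inner q q"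
definition divide_quat :: "quat \<Rightarrow> quat \<Rightarrow> quat" where
  "divide p q = p * inverse q" for p q :: quat

instance ..

end

instance quat :: real_normed_div_algebra
proof
  fix p q :: quat
  show "inverse (0::quat) = 0"
    by (simp add: quat_eq_iff inverse_quat_def inner_quat_def scaleR_quat_def zero_quat_def)
  show "p / q = p * inverse q"
    by (fact divide_quat_def)
  define c where "c = Quat (qre p) (- qi p) (- qj p) (- qk p)"
  have c: "c * p = inner p p *\<^sub>R 1" "p * c = inner p p *\<^sub>R 1"
    by (simp_all add: c_def quat_eq_iff times_quat_def inner_quat_def scaleR_quat_def one_quat_def)
  show "inverse p * p = 1" "p * inverse p = 1" if "p \<noteq> 0"
    using that by (simp_all add: inverse_quat_def c_def[symmetric] c)
  have "inner (p * q) (p * q) = inner p p * inner q q"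
    unfolding times_quat_def inner_quat_def quat.sel by algebra
  then show "norm (p * q) = norm p * norm q"
    by (simp add: norm_quat_def real_sqrt_mult)
qed

instantiation quat :: euclidean_space
begin

definition Basis_quat :: "quat set" where
  "Basis = {Quat 1 0 0 0, Quat 0 1 0 0, Quat 0 0 1 0, Quat 0 0 0 1}"

instance
proof
  fix u v :: quat
  show "inner u v = (if u = v then 1 else 0)" if "u \<in> Basis" "v \<in> Basis"
    using that unfolding Basis_quat_def by (elim insertE emptyE) (simp_all add: inner_quat_def)
  show "(\<forall>v\<in>Basis. inner u v = 0) \<longleftrightarrow> u = 0"
    by (cases u) (simp add: Basis_quat_def inner_quat_def zero_quat_def)
qed (simp_all add: Basis_quat_def)

end


section \<open>Regions and the skew product\<close>

definition conj_act :: "quat \<Rightarrow> quat \<Rightarrow> quat" where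
  "conj_act p q = p * q * inverse p"

definition orbit :: "quat \<Rightarrow> quat set" where
  "orbit q = {conj_act p q | p. p \<noteq> 0}"

definition invariant :: "quat set \<Rightarrow> bool" where
  "invariant X \<longleftrightarrow> (\<forall>q\<in>X. \<forall>p. p \<noteq> 0 \<longrightarrow> conj_act p q \<in> X)"

definition region :: "quat set \<Rightarrow> bool" where
  "region U \<longleftrightarrow> open U \<and> invariant U"

text \<open>A function on an invariant set \<open>X\<close> is represented by a total function whose values
  outside \<open>X\<close> are irrelevant: on an invariant set the skew product only uses values in that set.\<close>

definition skew_prod :: "(quat \<Rightarrow> quat) \<Rightarrow> (quat \<Rightarrow> quat) \<Rightarrow> quat \<Rightarrow> quat" (infixl \<open>\<diamond>\<close> 70) where
  "(F \<diamond> G) x = (if G x = 0 then 0 else F (conj_act (G x) x) * G x)"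

definition is_skew_inverse :: "quat set \<Rightarrow> (quat \<Rightarrow> quat) \<Rightarrow> (quat \<Rightarrow> quat) \<Rightarrow> bool" where
  "is_skew_inverse X F G \<longleftrightarrow> (\<forall>x\<in>X. (F \<diamond> G) x = 1 \<and> (G \<diamond> F) x = 1)"

text \<open>Extensionality makes the two-sided inverse on an invariant \<open>X\<close> unique as a total function.\<close>

definition skew_inverse :: "quat set \<Rightarrow> (quat \<Rightarrow> quat) \<Rightarrow> quat \<Rightarrow> quat" where
  "skew_inverse X F = (THE G. is_skew_inverse X F G \<and> G \<in> extensional X)"


section \<open>Skew regularity\<close>

definition skew_differentiable_at :: "quat set \<Rightarrow> (quat \<Rightarrow> quat) \<Rightarrow> quat \<Rightarrow> bool" where
  "skew_differentiable_at U F q \<longleftrightarrow>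
     (\<exists>D. (\<forall>p\<in>orbit q. continuous (at p within U) D) \<and>
          (\<forall>x\<in>U. F x = F q + (D \<diamond> (\<lambda>t. t - q)) x))"

definition skew_regular :: "quat set \<Rightarrow> (quat \<Rightarrow> quat) \<Rightarrow> bool" where
  "skew_regular U F \<longleftrightarrow> (\<forall>q\<in>U. skew_differentiable_at U F q)"

definition has_skew_deriv :: "quat set \<Rightarrow> (quat \<Rightarrow> quat) \<Rightarrow> quat \<Rightarrow> quat \<Rightarrow> bool" where
  "has_skew_deriv U F q\<^sub>0 l \<longleftrightarrow>
     (((\<lambda>q. F q - F q\<^sub>0) \<diamond> skew_inverse (- orbit q\<^sub>0) (\<lambda>q. q - q\<^sub>0)) \<longlongrightarrow> l)
       (at q\<^sub>0 within (U - orbit q\<^sub>0))"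

definition skew_deriv :: "quat set \<Rightarrow> (quat \<Rightarrow> quat) \<Rightarrow> quat \<Rightarrow> quat" where
  "skew_deriv U F q\<^sub>0 = (THE l. has_skew_deriv U F q\<^sub>0 l)"


section \<open>Slice regularity\<close>

definition imag_units :: "quat set" where
  "imag_units = {I. I\<^sup>2 = - 1}"

definition slice_pt :: "quat \<Rightarrow> real \<Rightarrow> real \<Rightarrow> quat" where
  "slice_pt I x y = of_real x + of_real y * I"

definition slice_dx :: "(quat \<Rightarrow> quat) \<Rightarrow> quat \<Rightarrow> real \<Rightarrow> real \<Rightarrow> quat" where
  "slice_dx F I x y = vector_derivative (\<lambda>s. F (slice_pt I s y)) (at x)"

definition slice_dy :: "(quat \<Rightarrow> quat) \<Rightarrow> quat \<Rightarrow> real \<Rightarrow> real \<Rightarrow> quat" where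
  "slice_dy F I x y = vector_derivative (\<lambda>t. F (slice_pt I x t)) (at y)"

definition slice_dom :: "quat set \<Rightarrow> quat \<Rightarrow> (real \<times> real) set" where
  "slice_dom U I = {(x, y). slice_pt I x y \<in> U}"

definition slice_regular :: "quat set \<Rightarrow> (quat \<Rightarrow> quat) \<Rightarrow> bool" where
  "slice_regular U F \<longleftrightarrow>
     (\<forall>I\<in>imag_units.
        (\<forall>(x, y)\<in>slice_dom U I.
           (\<lambda>s. F (slice_pt I s y)) differentiable (at x) \<and>
           (\<lambda>t. F (slice_pt I x t)) differentiable (at y)) \<and>
        continuous_on (slice_dom U I) (\<lambda>(x, y). slice_dx F I x y) \<and>
        continuous_on (slice_dom U I) (\<lambda>(x, y). slice_dy F I x y) \<and>
        (\<forall>(x, y)\<in>slice_dom U I.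
           (1/2) *\<^sub>R (slice_dx F I x y + slice_dy F I x y * I) = 0))"

text \<open>The slice derivative at \<open>x + y I\<close>, computed in the slice of \<open>I\<close>.  A point has several such
  presentations (\<open>\<plusminus>I\<close> off the real axis, every \<open>I\<close> on it), all giving the same value when \<open>F\<close> is
  slice regular.\<close>

definition slice_deriv :: "(quat \<Rightarrow> quat) \<Rightarrow> quat \<Rightarrow> real \<Rightarrow> real \<Rightarrow> quat" where
  "slice_deriv F I x y = (1/2) *\<^sub>R (slice_dx F I x y - slice_dy F I x y * I)"

end

theory Submission
  imports Defs "HOL-Complex_Analysis.Cauchy_Integral_Formula"
begin

text \<open>On a slice, \<open>x\<close> commutes with \<open>x - q\<close>, so skew differentiability at \<open>q\<close> reads
  \<open>F x = F q + D x * (x - q)\<close> there: \<open>F\<close> is complex differentiable for the right multiplication by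
  the slice, with derivative \<open>D q\<close>. The Cauchy--Riemann equation and the value of the slice
  derivative are then immediate. Continuity of the partial derivatives is Goursat's theorem,
  applied to the compositions of \<open>F\<close> with functionals \<open>\<ell>\<close> satisfying \<open>\<ell> (h * I) = \<i> * \<ell> h\<close>.
  Off the orbit of \<open>q\<close>, composing \<open>F - F q = D \<diamond> (T - q)\<close> on the right with the skew inverse of
  \<open>T - q\<close> gives back \<open>D\<close>, which tends to \<open>D q\<close>.\<close>

section \<open>Orbits\<close>

lemma mem_orbit_self: "q \<in> orbit q"
  unfolding orbit_def conj_act_def by (auto intro!: exI[of _ 1])

text \<open>A nonzero solution \<open>h\<close> of the homogeneous Sylvester equation has an
  inverse, and \<open>inverse h\<close> conjugates \<open>q\<close> to \<open>x\<close>. Hence off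
  the orbit of \<open>q\<close> the operator \<open>h * x - q * h\<close> has trivial
  kernel.\<close>

lemma mem_orbitI:
  assumes "h * x = q * h" "h \<noteq> 0"
  shows "x \<in> orbit q"
proof -
  have "inverse h * q * h = inverse h * (h * x)"
    by (simp add: assms(1) mult.assoc)
  also have "\<dots> = x"
    using assms(2) by (simp flip: mult.assoc)
  finally have "x = conj_act (inverse h) q"
    using assms(2) by (simp add: conj_act_def)
  then show ?thesis
    using assms(2) unfolding orbit_def by (auto intro!: exI[of _ "inverse h"])
qed

lemma conj_act_mult:
  assumes "p \<noteq> 0"
  shows "conj_act p x * p = p * x"
  using assms by (simp add: conj_act_def mult.assoc)

lemma conj_act_eq_self:
  assumes "p * x = x * p" "p \<noteq> 0"
  shows "conj_act p x = x"
  using assms by (simp add: conj_act_def mult.assoc)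

lemma conj_act_conj_act:
  assumes "p \<noteq> 0" "r \<noteq> 0"
  shows "conj_act p (conj_act r x) = conj_act (p * r) x"
  using assms by (simp add: conj_act_def mult.assoc nonzero_inverse_mult_distrib)

lemma conj_act_mem_orbit_iff:
  assumes "p \<noteq> 0"
  shows "conj_act p x \<in> orbit q \<longleftrightarrow> x \<in> orbit q"
proof -
  have *: "conj_act r y \<in> orbit q" if "y \<in> orbit q" "r \<noteq> 0" for r y
    using that conj_act_conj_act unfolding orbit_def by fastforce
  have "conj_act (inverse p) (conj_act p x) = x"
    using assms by (simp add: conj_act_conj_act) (simp add: conj_act_def)
  then show ?thesis
    using * assms by (metis nonzero_imp_inverse_nonzero)
qed

text \<open>The real part behaves like a trace: \<open>qre (a * b) = qre (b * a)\<close>, so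
  conjugation preserves it. This gives a simple test for lying off an orbit.\<close>

lemma qre_orbit:
  assumes "x \<in> orbit q"
  shows "qre x = qre q"
proof -
  obtain p where p: "p \<noteq> 0" "x = p * q * inverse p"
    using assms unfolding orbit_def conj_act_def by blast
  have "qre (a * b) = qre (b * a)" for a b
    by (simp add: times_quat_def)
  then have "qre x = qre (inverse p * (p * q))"
    using p by metis
  then show ?thesis
    using p by (simp flip: mult.assoc)
qed

text \<open>A small real translation of \<open>q\<close> changes the real part and so leaves the
  orbit. This makes the limit in the definition of the skew derivative unique.\<close>

lemma islimpt_minus_orbit:
  assumes "open U" "q \<in> U"
  shows "q islimpt (U - orbit q)"
  unfolding islimpt_approachable
proof (intro allI impI)
  fix e :: real
  assume "e > 0"
  obtain d where d: "d > 0" "ball q d \<subseteq> U"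
    using assms openE by blast
  define r where "r = min d e / 2"
  have r: "r > 0" "r < d" "r < e"
    using \<open>d > 0\<close> \<open>e > 0\<close> by (auto simp: r_def)
  let ?x = "q + of_real r"
  have dist: "dist ?x q = r"
    using r by (simp add: dist_norm)
  have "qre ?x = qre q + r"
    by (simp add: of_real_def plus_quat_def scaleR_quat_def one_quat_def)
  then have "?x \<notin> orbit q"
    using qre_orbit[of ?x q] r by auto
  moreover have "?x \<in> U"
    using d r dist by (auto simp: subset_iff dist_commute)
  ultimately show "\<exists>x'\<in>U - orbit q. x' \<noteq> q \<and> dist x' q < e"
    using r dist by (intro bexI[of _ ?x]) auto
qed

section \<open>The skew inverse of a linear factor\<close>

text \<open>At a point \<open>x\<close>, the equation \<open>(T - q) \<diamond> G = 1\<close> is the Sylvester equation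
  \<open>G x * x - q * G x = 1\<close>.\<close>

lemma sylvester_unique:
  assumes "x \<notin> orbit q" "g * x - q * g = h * x - q * h"
  shows "g = h"
proof (rule ccontr)
  assume "g \<noteq> h"
  moreover have "(g - h) * x = q * (g - h)"
    using assms(2) by (simp add: algebra_simps)
  ultimately show False
    using mem_orbitI[of "g - h" x q] assms(1) by simp
qed

text \<open>An injective real-linear endomorphism of a finite-dimensional space is
  surjective.\<close>

lemma sylvester_solvable:
  assumes "x \<notin> orbit q"
  shows "\<exists>g. g * x - q * g = c"
proof -
  let ?L = "\<lambda>g. g * x - q * g"
  have "linear ?L"
    by (intro linearI) (simp_all add: algebra_simps)
  moreover have "inj ?L"
    using sylvester_unique[OF assms] by (blast intro: injI)
  ultimately have "surj ?L"
    by (rule eucl.linear_inj_imp_surj)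
  then obtain g where "c = ?L g"
    by (rule surjE)
  then show ?thesis
    by (intro exI[of _ g]) (rule sym)
qed

text \<open>Conjugating by \<open>G x\<close> and then multiplying by it on the right turns
  \<open>x\<close> into \<open>G x * x\<close>. Where \<open>G x = 0\<close>, both sides fail
  because \<open>0 \<noteq> 1\<close>.\<close>

lemma linear_skew_prod_eq_1_iff:
  "((\<lambda>t. t - q) \<diamond> G) x = 1 \<longleftrightarrow> G x * x - q * G x = 1"
  by (auto simp: skew_prod_def left_diff_distrib conj_act_mult)

lemma skew_inverse_linear:
  assumes "x \<notin> orbit q"
  defines "G \<equiv> skew_inverse (- orbit q) (\<lambda>t. t - q)"
  shows "G x * x - q * G x = 1"
proof -
  let ?P = "\<lambda>G. is_skew_inverse (- orbit q) (\<lambda>t. t - q) G \<and> G \<in> extensional (- orbit q)"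
  \<comment> \<open>Pointwise solutions make \<open>H\<close> a right inverse;
    \<open>restrict\<close> places it among the extensional functions, where
    \<open>skew_inverse\<close> singles out a unique element.\<close>
  define H where "H = restrict (\<lambda>x. SOME g. g * x - q * g = 1) (- orbit q)"
  have H: "H x * x - q * H x = 1" if "x \<notin> orbit q" for x
    using someI_ex[OF sylvester_solvable[OF that]] that by (simp add: H_def)
  \<comment> \<open>The product is \<open>H ?y * (x - q)\<close> at the conjugate \<open>?y\<close>
    of \<open>x\<close>. Since \<open>inverse (x - q)\<close> solves the Sylvester equation at
    \<open>?y\<close>, uniqueness identifies it with \<open>H ?y\<close>.\<close>
  have left_inverse: "(H \<diamond> (\<lambda>t. t - q)) x = 1" if x: "x \<notin> orbit q" for x
  proof -
    have nz: "x - q \<noteq> 0"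
      using x mem_orbit_self by auto
    let ?y = "conj_act (x - q) x"
    have y: "?y \<notin> orbit q"
      using x nz by (simp add: conj_act_mem_orbit_iff)
    have "inverse (x - q) * ?y = x * inverse (x - q)"
      using nz by (simp add: conj_act_def flip: mult.assoc)
    then have "inverse (x - q) * ?y - q * inverse (x - q) = (x - q) * inverse (x - q)"
      by (simp add: left_diff_distrib)
    also have "\<dots> = 1"
      using nz by simp
    finally have "H ?y = inverse (x - q)"
      using sylvester_unique[OF y] H[OF y] by metis
    then show ?thesis
      using nz by (simp add: skew_prod_def)
  qed
  have "?P H"
    using H left_inverse
    by (simp add: is_skew_inverse_def linear_skew_prod_eq_1_iff) (simp add: H_def)
  moreover have "K = H" if "?P K" for K
  proof (rule extensionalityI[of _ "- orbit q"])
    show "K \<in> extensional (- orbit q)" "H \<in> extensional (- orbit q)"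
      using that \<open>?P H\<close> by auto
    show "K x = H x" if "x \<in> - orbit q" for x
      using that \<open>?P K\<close> H[of x] sylvester_unique[of x q "K x" "H x"]
      by (simp add: is_skew_inverse_def linear_skew_prod_eq_1_iff)
  qed
  ultimately have "?P G"
    unfolding G_def skew_inverse_def by (rule theI)
  then show ?thesis
    using assms(1) by (simp add: is_skew_inverse_def linear_skew_prod_eq_1_iff)
qed

text \<open>A pointwise instance of associativity of \<open>\<diamond>\<close>. With
  \<open>g\<close> the value of the skew inverse at \<open>x\<close>, conjugation by
  \<open>g\<close> sends \<open>x\<close> to a point \<open>?y\<close> with \<open>?y - q\<close>
  inverse to \<open>g\<close>; conjugation by \<open>?y - q\<close> therefore leads back to
  \<open>x\<close>, and the two factors cancel.\<close>

lemma skew_prod_linear_skew_inverse: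
  assumes "x \<notin> orbit q" "x \<in> U" "invariant U"
    and F: "\<And>y. y \<in> U \<Longrightarrow> F y = (D \<diamond> (\<lambda>t. t - q)) y"
  shows "(F \<diamond> skew_inverse (- orbit q) (\<lambda>t. t - q)) x = D x"
proof -
  define g where "g = skew_inverse (- orbit q) (\<lambda>t. t - q) x"
  have g: "g * x - q * g = 1"
    unfolding g_def by (rule skew_inverse_linear) fact
  then have nz: "g \<noteq> 0"
    by auto
  let ?y = "conj_act g x"
  have prod: "(?y - q) * g = 1"
    using g nz by (simp add: left_diff_distrib conj_act_mult)
  then have nz': "?y - q \<noteq> 0"
    by force
  have "conj_act (?y - q) ?y = conj_act ((?y - q) * g) x"
    using nz nz' by (rule conj_act_conj_act[rotated])
  also have "\<dots> = x"
    by (simp only: prod) (simp add: conj_act_def)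
  finally have "F ?y = D x * (?y - q)"
    using F[of ?y] assms(2,3) nz nz' by (simp add: invariant_def skew_prod_def)
  then have "F ?y * g = D x"
    by (simp only: mult.assoc prod mult_1_right)
  then show ?thesis
    using nz by (simp add: skew_prod_def flip: g_def)
qed

lemma has_skew_derivI:
  assumes "region U" "q \<in> U" "continuous (at q within U) D"
    and "\<And>x. x \<in> U \<Longrightarrow> F x = F q + (D \<diamond> (\<lambda>t. t - q)) x"
  shows "has_skew_deriv U F q (D q)"
proof -
  have "(D \<longlongrightarrow> D q) (at q within (U - orbit q))"
    using assms(3) by (auto simp: continuous_within intro: tendsto_within_subset)
  moreover have
    "((\<lambda>q'. F q' - F q) \<diamond> skew_inverse (- orbit q) (\<lambda>t. t - q)) x = D x" if "x \<in> U - orbit q" for x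
    using that assms(1,4) by (intro skew_prod_linear_skew_inverse[of _ _ U]) (auto simp: region_def)
  ultimately show ?thesis
    unfolding has_skew_deriv_def
    by (subst Lim_cong_within[OF refl refl refl]) auto
qed

lemma skew_deriv_eqI:
  assumes "region U" "q \<in> U" "has_skew_deriv U F q l"
  shows "skew_deriv U F q = l"
proof -
  have "at q within (U - orbit q) \<noteq> bot"
    using islimpt_minus_orbit assms(1,2) by (simp add: trivial_limit_within region_def)
  then show ?thesis
    using assms(3) unfolding skew_deriv_def has_skew_deriv_def
    by (intro the_equality) (auto intro: tendsto_unique)
qed

section \<open>Restriction to a slice\<close>

text \<open>The slice is parametrized by a complex variable so that holomorphy can be used on
  it.\<close>

definition slice_emb :: "quat \<Rightarrow> complex \<Rightarrow> quat" where
  "slice_emb I z = slice_pt I (Re z) (Im z)"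

lemma slice_emb_Complex [simp]: "slice_emb I (Complex x y) = slice_pt I x y"
  by (simp add: slice_emb_def)

lemma bounded_linear_slice_emb: "bounded_linear (slice_emb I)"
  unfolding slice_emb_def slice_pt_def
  by (intro bounded_linear_add bounded_linear_compose[OF bounded_linear_of_real bounded_linear_Re]
      bounded_linear_compose[OF bounded_linear_mult_left
        bounded_linear_compose[OF bounded_linear_of_real bounded_linear_Im]])

lemma slice_emb_commute: "slice_emb I w * slice_emb I z = slice_emb I z * slice_emb I w"
  unfolding slice_emb_def slice_pt_def of_real_def by (simp add: algebra_simps)

text \<open>Caratheodory's form of differentiability, with the increment kept to the right of the
  difference quotient \<open>g\<close>. The error of the linear approximation is
  \<open>g w - g z\<close> times the increment, and the first factor tends to 0.\<close>

lemma has_derivative_slice: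
  fixes f :: "complex \<Rightarrow> quat"
  assumes "\<forall>\<^sub>F w in at z. f w = f z + g w * slice_emb I (w - z)" "isCont g z"
  shows "(f has_derivative (\<lambda>h. g z * slice_emb I h)) (at z)"
proof -
  interpret E: bounded_linear "slice_emb I"
    by (rule bounded_linear_slice_emb)
  obtain K where K: "\<And>h. norm (slice_emb I h) \<le> norm h * K"
    using E.bounded by blast
  have "bounded_linear (\<lambda>h. g z * slice_emb I h)"
    by (intro bounded_linear_compose[OF bounded_linear_mult_right] bounded_linear_slice_emb)
  moreover have "((\<lambda>w. norm (f w - f z - g z * slice_emb I (w - z)) / norm (w - z)) \<longlongrightarrow> 0) (at z)"
  proof (rule Lim_null_comparison)
    have "((\<lambda>w. norm (g w - g z) * K) \<longlongrightarrow> norm (g z - g z) * K) (at z)"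
      using assms(2) unfolding isCont_def by (intro tendsto_intros)
    then show "((\<lambda>w. norm (g w - g z) * K) \<longlongrightarrow> 0) (at z)"
      by simp
    show "\<forall>\<^sub>F w in at z.
        norm (norm (f w - f z - g z * slice_emb I (w - z)) / norm (w - z)) \<le> norm (g w - g z) * K"
      using assms(1) eventually_neq_at_within[of z]
    proof eventually_elim
      case (elim w)
      then have "f w - f z - g z * slice_emb I (w - z) = (g w - g z) * slice_emb I (w - z)"
        by (simp add: algebra_simps)
      then have "norm (f w - f z - g z * slice_emb I (w - z)) \<le> norm (g w - g z) * (norm (w - z) * K)"
        using K by (simp add: norm_mult mult_left_mono)
      then show ?case
        using elim by (simp add: divide_le_eq mult_ac)
    qed
  qed
  ultimately show ?thesis
    by (simp add: has_derivative_iff_norm)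
qed

lemma skew_differentiable_imp_has_derivative_slice:
  assumes "open U" "slice_emb I z \<in> U" "continuous (at (slice_emb I z) within U) D"
    and F: "\<And>x. x \<in> U \<Longrightarrow> F x = F (slice_emb I z) + (D \<diamond> (\<lambda>t. t - slice_emb I z)) x"
  shows "((\<lambda>w. F (slice_emb I w)) has_derivative (\<lambda>h. D (slice_emb I z) * slice_emb I h)) (at z)"
proof (rule has_derivative_slice)
  interpret E: bounded_linear "slice_emb I"
    by (rule bounded_linear_slice_emb)
  have cont: "isCont (slice_emb I) z"
    using bounded_linear_slice_emb by (rule linear_continuous_at)
  have "isCont D (slice_emb I z)"
    using assms(3) unfolding at_within_open[OF assms(2,1)] .
  then show "isCont (\<lambda>w. D (slice_emb I w)) z"
    by (rule isCont_o2[OF cont])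
  have "\<forall>\<^sub>F w in at z. slice_emb I w \<in> U"
    using cont assms(1,2) by (auto simp: isCont_def dest: topological_tendstoD)
  then show "\<forall>\<^sub>F w in at z.
      F (slice_emb I w) = F (slice_emb I z) + D (slice_emb I w) * slice_emb I (w - z)"
  proof eventually_elim
    case (elim w)
    \<comment> \<open>A slice is commutative, so conjugation by the difference fixes
      \<open>slice_emb I w\<close> and the skew product becomes an ordinary one. If the difference
      is 0, both products vanish.\<close>
    have "(slice_emb I w - slice_emb I z) * slice_emb I w = slice_emb I w * (slice_emb I w - slice_emb I z)"
      by (simp add: algebra_simps slice_emb_commute)
    then show ?case
      using F[OF elim] conj_act_eq_self by (auto simp: skew_prod_def E.diff)
  qed
qed

lemma continuous_on_slice_derivative:
  fixes f :: "complex \<Rightarrow> quat"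
  assumes I: "I \<in> imag_units" and S: "open S"
    and f: "\<And>z. z \<in> S \<Longrightarrow> (f has_derivative (\<lambda>h. e z * slice_emb I h)) (at z)"
  shows "continuous_on S e"
proof -
  have cont: "continuous_on S (\<lambda>z. inner (e z) w)" for w
  proof -
    \<comment> \<open>The real part is the coordinate to be shown continuous; the imaginary part is
      then forced by \<open>l (h * I) = \<i> * l h\<close>, which turns right multiplication by the
      slice into complex multiplication.\<close>
    define l where "l h = Complex (inner h w) (- inner (h * I) w)" for h
    have II: "I * I = -1"
      using I by (simp add: imag_units_def power2_eq_square)
    have l: "bounded_linear l"
      unfolding l_def
      by (simp add: linear_linear linearI inner_add_left distrib_right complex_eq_iff)
    have lin: "l (e z * slice_emb I h) = l (e z) * h" for z h
      by (simp add: l_def slice_emb_def slice_pt_def of_real_def complex_eq_iff algebra_simps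
          inner_add_left II)
    have deriv: "((\<lambda>z. l (f z)) has_field_derivative l (e z)) (at z)" if "z \<in> S" for z
      using bounded_linear.has_derivative[OF l f[OF that]]
      unfolding has_field_derivative_def by (simp add: lin fun_eq_iff[of "(*) (l (e z))"])
    then have "(\<lambda>z. l (f z)) holomorphic_on S"
      using S by (auto simp: holomorphic_on_open)
    \<comment> \<open>Goursat's theorem enters here: complex differentiability on an open set makes
      the derivative holomorphic, hence continuous.\<close>
    then have "continuous_on S (deriv (\<lambda>z. l (f z)))"
      using S by (intro holomorphic_on_imp_continuous_on holomorphic_deriv)
    then have "continuous_on S (\<lambda>z. l (e z))"
      by (rule continuous_on_eq) (simp add: DERIV_imp_deriv deriv)
    then have "continuous_on S (\<lambda>z. Re (l (e z)))"
      by (intro continuous_intros)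
    then show ?thesis
      by (simp add: l_def)
  qed
  then show ?thesis
    by (subst continuous_on_componentwise) auto
qed

lemma slice_partial_derivatives:
  assumes "((\<lambda>w. F (slice_emb I w)) has_derivative (\<lambda>h. c * slice_emb I h)) (at (Complex x y))"
  shows "((\<lambda>s. F (slice_pt I s y)) has_vector_derivative c) (at x)"
    and "((\<lambda>t. F (slice_pt I x t)) has_vector_derivative c * I) (at y)"
proof -
  have "((\<lambda>s. Complex s y) has_derivative (\<lambda>h. Complex h 0)) (at x)"
    unfolding Complex_eq by (auto intro!: derivative_eq_intros)
  from has_derivative_compose[OF this assms]
  show "((\<lambda>s. F (slice_pt I s y)) has_vector_derivative c) (at x)"
    by (simp add: has_vector_derivative_def slice_pt_def of_real_def)
  have "((\<lambda>t. Complex x t) has_derivative (\<lambda>h. Complex 0 h)) (at y)"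
    unfolding Complex_eq by (auto intro!: derivative_eq_intros)
  from has_derivative_compose[OF this assms]
  show "((\<lambda>t. F (slice_pt I x t)) has_vector_derivative c * I) (at y)"
    by (simp add: has_vector_derivative_def slice_pt_def of_real_def)
qed

theorem proposition3p19:
  fixes F :: "quat \<Rightarrow> quat" and U :: "quat set"
  assumes "region U"
    and "skew_regular U F"
  shows "slice_regular U F \<and>
    (\<forall>q\<in>U. has_skew_deriv U F q (skew_deriv U F q)) \<and>
    (\<forall>I\<in>imag_units. \<forall>x y. slice_pt I x y \<in> U \<longrightarrow>
       skew_deriv U F (slice_pt I x y) = slice_deriv F I x y)"
proof -
  have "open U"
    using assms(1) by (simp add: region_def)
  define e where "e = skew_deriv U F"
  have skew: "has_skew_deriv U F q (e q)"
    and slice: "q = slice_emb I z \<Longrightarrow>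
      ((\<lambda>w. F (slice_emb I w)) has_derivative (\<lambda>h. e q * slice_emb I h)) (at z)"
    if "q \<in> U" for q I z
  proof -
    \<comment> \<open>The function \<open>D\<close> varies with \<open>q\<close>. Only its value
      \<open>D q\<close> is kept, and uniqueness of the skew derivative identifies it with
      \<open>e q\<close>, where \<open>e\<close> is a single function on all of
      \<open>U\<close>.\<close>
    obtain D where D: "\<forall>p\<in>orbit q. continuous (at p within U) D"
      "\<And>x. x \<in> U \<Longrightarrow> F x = F q + (D \<diamond> (\<lambda>t. t - q)) x"
      using assms(2) \<open>q \<in> U\<close> unfolding skew_regular_def skew_differentiable_at_def by blast
    have cont: "continuous (at q within U) D"
      using D(1) mem_orbit_self by blast
    have "has_skew_deriv U F q (D q)"
      using assms(1) \<open>q \<in> U\<close> cont D(2) by (rule has_skew_derivI)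
    moreover from this have "e q = D q"
      unfolding e_def using assms(1) \<open>q \<in> U\<close> by (intro skew_deriv_eqI)
    ultimately show "has_skew_deriv U F q (e q)"
      by simp
    show "((\<lambda>w. F (slice_emb I w)) has_derivative (\<lambda>h. e q * slice_emb I h)) (at z)"
      if "q = slice_emb I z"
      unfolding \<open>e q = D q\<close> using \<open>open U\<close> \<open>q \<in> U\<close> cont D(2) unfolding that
      by (rule skew_differentiable_imp_has_derivative_slice)
  qed
  have partials:
    "((\<lambda>s. F (slice_pt I s y)) has_vector_derivative e (slice_pt I x y)) (at x)"
    "((\<lambda>t. F (slice_pt I x t)) has_vector_derivative e (slice_pt I x y) * I) (at y)"
    "slice_dx F I x y = e (slice_pt I x y)"
    "slice_dy F I x y = e (slice_pt I x y) * I"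
    if "slice_pt I x y \<in> U" for I x y
  proof -
    have deriv: "((\<lambda>w. F (slice_emb I w)) has_derivative (\<lambda>h. e (slice_pt I x y) * slice_emb I h))
        (at (Complex x y))"
      using that by (intro slice) simp_all
    show "((\<lambda>s. F (slice_pt I s y)) has_vector_derivative e (slice_pt I x y)) (at x)"
      "((\<lambda>t. F (slice_pt I x t)) has_vector_derivative e (slice_pt I x y) * I) (at y)"
      using slice_partial_derivatives[OF deriv] .
    then show "slice_dx F I x y = e (slice_pt I x y)" "slice_dy F I x y = e (slice_pt I x y) * I"
      by (simp_all add: slice_dx_def slice_dy_def vector_derivative_at)
  qed
  have cont: "continuous_on (slice_dom U I) (\<lambda>(x, y). e (slice_pt I x y))" if "I \<in> imag_units" for I
  proof -
    define S where "S = slice_emb I -` U"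
    have "open S"
      unfolding S_def using \<open>open U\<close> linear_continuous_on[OF bounded_linear_slice_emb]
      by (rule open_vimage)
    then have "continuous_on S (\<lambda>z. e (slice_emb I z))"
      using that slice by (intro continuous_on_slice_derivative[of I S]) (auto simp: S_def)
    moreover have "continuous_on (slice_dom U I) (\<lambda>p. Complex (fst p) (snd p))"
      unfolding Complex_eq by (intro continuous_intros)
    ultimately have "continuous_on (slice_dom U I) (\<lambda>p. e (slice_emb I (Complex (fst p) (snd p))))"
      by (rule continuous_on_compose2) (auto simp: S_def slice_dom_def)
    then show ?thesis
      by (simp add: case_prod_beta)
  qed
  \<comment> \<open>With partial derivatives \<open>c\<close> and \<open>c * I\<close>, this gives
    both \<open>c + c * I * I = 0\<close>, the Cauchy-Riemann equation, and
    \<open>c - c * I * I = 2 * c\<close>, whose half is the slice derivative.\<close>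
  have II: "c * I * I = - c" if "I \<in> imag_units" for c I
    using that by (simp add: imag_units_def power2_eq_square mult.assoc)
  have "slice_regular U F"
    unfolding slice_regular_def
  proof (intro ballI conjI)
    fix I
    assume I: "I \<in> imag_units"
    show "continuous_on (slice_dom U I) (\<lambda>(x, y). slice_dx F I x y)"
      by (rule continuous_on_eq[OF cont[OF I]]) (auto simp: slice_dom_def partials(3))
    show "continuous_on (slice_dom U I) (\<lambda>(x, y). slice_dy F I x y)"
      by (rule continuous_on_eq[OF continuous_on_mult_right[OF cont[OF I], of I]])
        (auto simp: slice_dom_def partials(4))
  qed (auto simp: slice_dom_def partials(3,4) II
        intro: partials(1,2)[THEN differentiableI_vector])
  moreover have "e (slice_pt I x y) = slice_deriv F I x y"
    if "I \<in> imag_units" "slice_pt I x y \<in> U" for I x y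
    using that by (simp add: slice_deriv_def partials(3,4) II scaleR_2[symmetric])
  ultimately show ?thesis
    using skew by (auto simp: e_def)
qed

end
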